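(* There is an absolute constant $C>0$ such that the following holds. Let $K$ be a compact subset of $\mathbb{R}^2$ with nonempty interior, and put $C_K = C\,\operatorname{diam}(K)^2$. Then for all $f \in C^2(\mathbb{R}^2)$, $$\bigl(\operatorname{osc}_K f - \operatorname{osc}_{\partial K} f\bigr)^2 \le C_K \int_K |\det D^2 f(x)|\,\mathrm{d}x .$$
   Context: For a nonempty compact set $A\subseteq\mathbb{R}^2$ and a continuous function $f$, $\operatorname{osc}_A f := \sup_A f - \inf_A f$. $\partial K$ is the topological boundary of $K$ in $\mathbb{R}^2$, $D^2 f$ is the Hessian matrix of $f$, and $\operatorname{diam}(K)$ is the Euclidean diameter of $K$. *)

theory Defs
  imports "HOL-Analysis.Analysis"
begin

text \<open>Meaningful when \<open>A\<close> is nonempty and \<open>f\<close> is bounded on \<open>A\<close>, in particular for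
  nonempty compact \<open>A\<close> and continuous \<open>f\<close>.\<close>

definition osc :: "'a set \<Rightarrow> ('a \<Rightarrow> real) \<Rightarrow> real" where
  "osc A f = (SUP x\<in>A. f x) - (INF x\<in>A. f x)"

definition grad :: "(real^'n \<Rightarrow> real) \<Rightarrow> real^'n \<Rightarrow> real^'n" where
  "grad f x = (\<chi> i. frechet_derivative f (at x) (axis i 1))"

text \<open>The \<open>(i, j)\<close> entry is the \<open>j\<close>-th partial derivative of the \<open>i\<close>-th partial derivative.\<close>

definition hessian :: "(real^'n \<Rightarrow> real) \<Rightarrow> real^'n \<Rightarrow> real^'n^'n" where
  "hessian f x = jacobian (grad f) (at x)"

text \<open>Class \<open>C\<^sup>2\<close> on the whole space. Continuity of \<open>f\<close> and of its gradient follows from their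
  differentiability.\<close>

definition C2 :: "(real^'n \<Rightarrow> real) \<Rightarrow> bool" where
  "C2 f \<longleftrightarrow> (\<forall>x. f differentiable (at x)) \<and> (\<forall>x. grad f differentiable (at x))
     \<and> continuous_on UNIV (hessian f)"

end

theory Submission
  imports Defs
begin

text \<open>
  The oscillation excess of \<open>f\<close> over \<open>K\<close> is the sum of the excess of its maximum and the excess
  of its minimum, and replacing \<open>f\<close> by \<open>-f\<close> turns one into the other without changing the
  determinant of the Hessian, since the dimension is even. It is therefore enough to bound
  \<open>M = max\<^bsub>K\<^esub> f - max\<^bsub>\<partial>K\<^esub> f\<close>, and this is Alexandrov's argument. Write \<open>d\<close> for the diameter
  of \<open>K\<close>. A plane of slope \<open>p\<close> with \<open>|p| < M / d\<close> varies by less than \<open>M\<close> over \<open>K\<close>, so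
  subtracting it from \<open>f\<close> cannot move the maximum to the boundary: \<open>x \<mapsto> f x - p \<bullet> x\<close> is maximal
  at an interior point, where \<open>\<nabla>f = p\<close>. Hence \<open>\<nabla>f\<close> maps \<open>K\<close> onto a set containing the ball of
  radius \<open>M / d\<close> (\<open>ball_subset_grad_image\<close>), whose area \<open>\<pi> (M / d)\<^sup>2\<close> is at most the integral of
  the Jacobian determinant \<open>|det D\<^sup>2f|\<close> of \<open>\<nabla>f\<close> over \<open>K\<close> (\<open>max_excess_bound\<close>). Adding the two
  bounds with \<open>(M + m)\<^sup>2 \<le> 2 M\<^sup>2 + 2 m\<^sup>2\<close> gives the constant \<open>4 / \<pi>\<close>.
\<close>

lemma frechet_derivative_eq_grad:
  fixes f :: "real^'n \<Rightarrow> real"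
  assumes "f differentiable (at x)"
  shows "frechet_derivative f (at x) h = grad f x \<bullet> h"
proof -
  interpret linear "frechet_derivative f (at x)"
    using assms by (rule linear_frechet_derivative)
  have "frechet_derivative f (at x) h = frechet_derivative f (at x) (\<Sum>i\<in>UNIV. h $ i *\<^sub>R axis i 1)"
    using basis_expansion[of h] by (simp add: scalar_mult_eq_scaleR)
  also have "\<dots> = (\<Sum>i\<in>UNIV. h $ i * frechet_derivative f (at x) (axis i 1))"
    by (simp add: sum scale)
  finally show ?thesis
    by (simp add: grad_def inner_vec_def mult.commute)
qed

text \<open>
  For \<open>|p| < M / d\<close>, passing from \<open>x0\<close> to a frontier point lowers \<open>f\<close> by at least \<open>M\<close> and
  changes \<open>p \<bullet> x\<close> by less than \<open>M\<close>. So \<open>f x - p \<bullet> x\<close> is smaller on the whole frontier than at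
  \<open>x0\<close>, its maximum over \<open>K\<close> is interior, and a critical point of it solves \<open>\<nabla>f = p\<close>.
\<close>

lemma ball_subset_grad_image:
  fixes f :: "real^'n \<Rightarrow> real"
  assumes "compact K" "x0 \<in> K" "d > 0"
    and diff: "\<And>x. f differentiable (at x)"
    and near: "\<And>y. y \<in> K \<Longrightarrow> dist x0 y \<le> d"
    and drop: "\<And>y. y \<in> frontier K \<Longrightarrow> f y + M \<le> f x0"
  shows "ball 0 (M / d) \<subseteq> grad f ` K"
proof
  fix p :: "real^'n"
  assume "p \<in> ball 0 (M / d)"
  then have p: "norm p * d < M"
    using \<open>d > 0\<close> by (simp add: pos_less_divide_eq)
  define g where "g x = f x - p \<bullet> x" for x
  have der: "(g has_derivative (\<lambda>h. grad f x \<bullet> h - p \<bullet> h)) (at x)" for x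
  proof -
    have "(f has_derivative frechet_derivative f (at x)) (at x)"
      using diff by (simp add: frechet_derivative_works)
    moreover have "frechet_derivative f (at x) = (\<lambda>h. grad f x \<bullet> h)"
      by (rule ext) (rule frechet_derivative_eq_grad[OF diff])
    ultimately have "(f has_derivative (\<lambda>h. grad f x \<bullet> h)) (at x)"
      by simp
    then show ?thesis
      unfolding g_def by (auto intro!: derivative_eq_intros)
  qed
  then have "continuous_on K g"
    by (meson continuous_at_imp_continuous_on has_derivative_continuous)
  then obtain x where x: "x \<in> K" "\<And>y. y \<in> K \<Longrightarrow> g y \<le> g x"
    using continuous_attains_sup[of K g] assms(1,2) by blast
  have "x \<notin> frontier K"
  proof
    assume "x \<in> frontier K"
    have "p \<bullet> (x0 - x) \<le> norm p * norm (x0 - x)"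
      by (rule norm_cauchy_schwarz)
    also have "\<dots> \<le> norm p * d"
      using near[OF x(1)] by (simp add: dist_norm mult_left_mono)
    finally have "f x0 - f x < M"
      using p x(2)[OF \<open>x0 \<in> K\<close>] by (simp add: g_def inner_diff_right)
    with drop[OF \<open>x \<in> frontier K\<close>] show False by simp
  qed
  then have int: "x \<in> interior K"
    using x(1) closure_subset by (auto simp: frontier_def)
  have "(\<lambda>h. grad f x \<bullet> h - p \<bullet> h) = (\<lambda>h. 0)"
    by (rule differential_zero_maxmin[OF int open_interior der])
      (use x(2) interior_subset in blast)
  then have "(grad f x - p) \<bullet> (grad f x - p) = 0"
    by (simp add: inner_diff_left fun_eq_iff)
  then show "p \<in> grad f ` K"
    using x(1) by auto
qed

lemma hessian_works:
  assumes "C2 f"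
  shows "(grad f has_derivative (\<lambda>h. hessian f x *v h)) (at x)"
  using assms jacobian_works[of "grad f" "at x"] by (simp add: C2_def hessian_def)

lemma continuous_on_abs_det_hessian:
  fixes f :: "real^2 \<Rightarrow> real"
  assumes "C2 f"
  shows "continuous_on A (\<lambda>x. \<bar>det (hessian f x)\<bar>)"
proof -
  have "continuous_on A (hessian f)"
    using assms continuous_on_subset by (auto simp: C2_def)
  then show ?thesis
    unfolding det_2 by (intro continuous_intros)
qed

lemma integral_abs_det_hessian:
  fixes f :: "real^2 \<Rightarrow> real"
  assumes "C2 f" "compact K"
  shows "(LINT x:K|lborel. \<bar>det (hessian f x)\<bar>) = integral K (\<lambda>x. \<bar>det (hessian f x)\<bar>)"
    and "(\<lambda>x. \<bar>det (hessian f x)\<bar>) integrable_on K"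
proof -
  have "set_integrable lborel K (\<lambda>x. \<bar>det (hessian f x)\<bar>)"
    unfolding set_integrable_def
    using borel_integrable_compact[OF assms(2) continuous_on_abs_det_hessian[OF assms(1)]]
    by (simp add: if_distrib indicator_def cong: if_cong)
  from set_borel_integral_eq_integral[OF this] show
    "(LINT x:K|lborel. \<bar>det (hessian f x)\<bar>) = integral K (\<lambda>x. \<bar>det (hessian f x)\<bar>)"
    "(\<lambda>x. \<bar>det (hessian f x)\<bar>) integrable_on K"
    by auto
qed

text \<open>
  The Jacobian matrix of \<open>\<nabla>f\<close> is the Hessian, and the integral of \<open>|det D\<^sup>2f|\<close> over \<open>K\<close> counts
  each value of \<open>\<nabla>f\<close> as often as it is taken, so it dominates the area of \<open>\<nabla>f(K)\<close> and with it
  the area of the disc contained there.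
\<close>

lemma max_excess_bound:
  fixes f :: "real^2 \<Rightarrow> real"
  assumes "C2 f" "compact K" "x0 \<in> K" "0 < d" "0 \<le> M"
    and near: "\<And>y. y \<in> K \<Longrightarrow> dist x0 y \<le> d"
    and drop: "\<And>y. y \<in> frontier K \<Longrightarrow> f y + M \<le> f x0"
  shows "M\<^sup>2 \<le> d\<^sup>2 / pi * (LINT x:K|lborel. \<bar>det (hessian f x)\<bar>)"
proof -
  let ?I = "LINT x:K|lborel. \<bar>det (hessian f x)\<bar>"
  have K: "K \<in> sets lebesgue" "K \<in> lmeasurable"
    using assms(2) lmeasurable_compact fmeasurableD by blast+
  have der: "(grad f has_derivative (\<lambda>h. hessian f x *v h)) (at x within K)" for x
    using hessian_works[OF assms(1)] has_derivative_at_withinI by blast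
  have int: "(\<lambda>x. \<bar>det (matrix (\<lambda>h. hessian f x *v h))\<bar>) integrable_on K"
    using integral_abs_det_hessian(2)[OF assms(1,2)] by simp
  have sub: "ball 0 (M / d) \<subseteq> grad f ` K"
    using assms by (intro ball_subset_grad_image) (auto simp: C2_def)
  have "pi * (M / d)\<^sup>2 = measure lebesgue (ball (0::real^2) (M / d))"
    using assms(4,5) by (simp add: content_ball unit_ball_vol_2)
  also have "\<dots> \<le> measure lebesgue (grad f ` K)"
    using measurable_differentiable_image[OF K(1) der int] sub
    by (intro measure_mono_fmeasurable) auto
  also have "\<dots> \<le> ?I"
    using measure_differentiable_image[OF K(1) der int]
      integral_abs_det_hessian(1)[OF assms(1,2)] by simp
  finally show ?thesis
    using \<open>0 < d\<close> by (simp add: field_simps)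
qed

lemma grad_uminus:
  assumes "C2 f"
  shows "grad (\<lambda>x. - f x) x = - grad f x"
proof -
  have "(f has_derivative frechet_derivative f (at x)) (at x)"
    using assms by (simp add: C2_def frechet_derivative_works[symmetric])
  then have "((\<lambda>x. - f x) has_derivative (\<lambda>h. - frechet_derivative f (at x) h)) (at x)"
    by (rule has_derivative_minus)
  from frechet_derivative_at[OF this, symmetric] show ?thesis
    by (simp add: grad_def vec_eq_iff)
qed

lemma hessian_uminus:
  assumes "C2 f"
  shows "hessian (\<lambda>x. - f x) x = - hessian f x"
proof -
  have "((\<lambda>x. - grad f x) has_derivative (\<lambda>h. - (hessian f x *v h))) (at x)"
    by (rule has_derivative_minus[OF hessian_works[OF assms]])
  moreover have "(\<lambda>h. - (hessian f x *v h)) = (\<lambda>h. (- hessian f x) *v h)"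
    by (simp add: fun_eq_iff vec_eq_iff matrix_vector_mult_def sum_negf)
  ultimately have "frechet_derivative (\<lambda>x. - grad f x) (at x) = (\<lambda>h. (- hessian f x) *v h)"
    using frechet_derivative_at by force
  moreover have "grad (\<lambda>x. - f x) = (\<lambda>x. - grad f x)"
    using grad_uminus[OF assms] by auto
  ultimately show ?thesis
    by (simp add: hessian_def[of "\<lambda>x. - f x"] jacobian_def)
qed

lemma C2_uminus:
  assumes "C2 f"
  shows "C2 (\<lambda>x. - f x)"
proof -
  have "grad (\<lambda>x. - f x) = (\<lambda>x. - grad f x)" "hessian (\<lambda>x. - f x) = (\<lambda>x. - hessian f x)"
    using grad_uminus[OF assms] hessian_uminus[OF assms] by auto
  then show ?thesis
    using assms by (auto simp: C2_def intro!: continuous_intros derivative_intros)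
qed

theorem theorem2p6:
  shows "\<exists>C::real. C > 0 \<and>
    (\<forall>(K::(real^2) set) (CK::real).
      compact K \<longrightarrow> interior K \<noteq> {} \<longrightarrow> CK = C * (diameter K)\<^sup>2 \<longrightarrow>
        (\<forall>f::real^2 \<Rightarrow> real. C2 f \<longrightarrow>
          (osc K f - osc (frontier K) f)\<^sup>2 \<le> CK * (LINT x:K|lborel. \<bar>det (hessian f x)\<bar>)))"
proof (intro exI[of _ "4 / pi"] conjI allI impI)
  show "4 / pi > 0" by simp
next
  fix K :: "(real^2) set" and CK :: real and f :: "real^2 \<Rightarrow> real"
  assume K: "compact K" "interior K \<noteq> {}" and CK: "CK = 4 / pi * (diameter K)\<^sup>2" and f: "C2 f"
  let ?F = "frontier K" and ?d = "diameter K"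
  let ?I = "LINT x:K|lborel. \<bar>det (hessian f x)\<bar>"
  have near: "dist x y \<le> ?d" if "x \<in> K" "y \<in> K" for x y
    using that K(1) by (simp add: compact_imp_bounded diameter_bounded_bound)
  have "0 < ?d"
  proof -
    obtain x e where e: "e > 0" "cball x e \<subseteq> K"
      using K(2) by (auto simp: mem_interior_cball)
    then have "diameter (cball x e) \<le> ?d"
      using K(1) by (intro diameter_subset compact_imp_bounded)
    then show ?thesis using e(1) by simp
  qed
  have "K \<noteq> {}" using K(2) interior_subset by blast
  have FK: "?F \<subseteq> K"
    using K(1) by (simp add: compact_imp_closed frontier_subset_closed)
  have F: "?F \<noteq> {}" "compact ?F"
    using K(1) \<open>K \<noteq> {}\<close> compact_frontier by (auto simp: frontier_eq_empty)
  have cont: "continuous_on A f" for A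
    using f by (auto simp: C2_def intro: continuous_at_imp_continuous_on differentiable_imp_continuous_within)
  have bdd: "bdd_above (f ` K)" "bdd_below (f ` K)" "bdd_above (f ` ?F)" "bdd_below (f ` ?F)"
    using K(1) F(2) cont
    by (auto intro!: bounded_imp_bdd_above bounded_imp_bdd_below compact_imp_bounded compact_continuous_image)
  obtain a where a: "a \<in> K" "\<And>y. y \<in> K \<Longrightarrow> f y \<le> f a"
    using continuous_attains_sup[OF K(1) \<open>K \<noteq> {}\<close> cont] by blast
  obtain b where b: "b \<in> K" "\<And>y. y \<in> K \<Longrightarrow> f b \<le> f y"
    using continuous_attains_inf[OF K(1) \<open>K \<noteq> {}\<close> cont] by blast
  define M where "M = f a - (SUP x\<in>?F. f x)"
  define m where "m = (INF x\<in>?F. f x) - f b"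
  have "(SUP x\<in>K. f x) = f a" "(INF x\<in>K. f x) = f b"
    using a b by (auto intro!: cSup_eq_maximum cInf_eq_minimum)
  then have osc: "osc K f - osc ?F f = M + m"
    by (simp add: osc_def M_def m_def)
  have "0 \<le> M" "0 \<le> m"
    using F(1) FK a(2) b(2) by (auto simp: M_def m_def intro!: cSUP_least cINF_greatest)
  have M: "M\<^sup>2 \<le> ?d\<^sup>2 / pi * ?I"
    using near a(1) \<open>0 \<le> M\<close> \<open>0 < ?d\<close> bdd(3) f K(1)
    by (intro max_excess_bound[of f K a]) (auto simp: M_def intro: cSUP_upper)
  have "m\<^sup>2 \<le> ?d\<^sup>2 / pi * (LINT x:K|lborel. \<bar>det (hessian (\<lambda>x. - f x) x)\<bar>)"
    using near b(1) \<open>0 \<le> m\<close> \<open>0 < ?d\<close> bdd(4) C2_uminus[OF f] K(1)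
    by (intro max_excess_bound[of "\<lambda>x. - f x" K b]) (auto simp: m_def intro: cINF_lower)
  then have m: "m\<^sup>2 \<le> ?d\<^sup>2 / pi * ?I"
    by (simp add: hessian_uminus[OF f] det_2)
  have "(M + m)\<^sup>2 \<le> 2 * M\<^sup>2 + 2 * m\<^sup>2"
    using sum_squares_bound[of M m] by (simp add: power2_sum)
  also have "\<dots> \<le> CK * ?I"
    using M m by (simp add: CK)
  finally show "(osc K f - osc ?F f)\<^sup>2 \<le> CK * ?I"
    by (simp add: osc)
qed

end
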